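(* Let $p\ge 1$ be an integer. There exists a universal polynomial $Q_p\in\mathbb{Z}[X_1,\dots,X_p,Y_1,\dots,Y_p]$, independent of $n$ and $m$, such that for all integers $n\ge p$ and $m\ge p$, $$\Sigma_p^{n\otimes m}=Q_p(\Sigma_1^X,\dots,\Sigma_p^X,\Sigma_1^Y,\dots,\Sigma_p^Y)$$ in $\mathbb{Z}[X_1,\dots,X_n,Y_1,\dots,Y_m]$. Moreover $$(-1)^pQ_p(X_1,\dots,X_p,Y_1,\dots,Y_p)=-p\,X_pY_p+P_p(X_1,\dots,X_p,Y_1,\dots,Y_p),$$ where the polynomial $P_p$ does not contain the monomial $X_pY_p$, and every monomial of $P_p$ has weight $2p$.
   Context: For two sets of variables $(X_1,\dots,X_n)$ and $(Y_1,\dots,Y_m)$, $\Sigma_k^X$ (resp. $\Sigma_k^Y$) denotes the $k$-th elementary symmetric polynomial in $X_1,\dots,X_n$ (resp. $Y_1,\dots,Y_m$), and $\Sigma_p^{n\otimes m}=\sum (X_{i_1}Y_{j_1})\cdots(X_{i_p}Y_{j_p})$, where the sum runs over all $p$-element subsets $\{(i_1,j_1),\dots,(i_p,j_p)\}$ of $\{1,\dots,n\}\times\{1,\dots,m\}$; i.e. it is the $p$-th elementary symmetric polynomial in the $nm$ products $X_iY_j$. The weight of a monomial $X_1^{n_1}\cdots X_p^{n_p}Y_1^{m_1}\cdots Y_p^{m_p}$ is $\sum_i i\,n_i+\sum_j j\,m_j$. *)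

theory Defs
  imports "HOL-Library.Poly_Mapping"
begin

text \<open>
  Polynomials with integer coefficients in two countable families of variables, as finitely
  supported maps from monomials (exponent maps) to coefficients.  The ring
  \<open>\<int>[X\<^sub>1,\<dots>,X\<^sub>n,Y\<^sub>1,\<dots>,Y\<^sub>m]\<close> is the subring \<open>polys n m\<close> below; since all of these
  rings embed in one type, polynomials for different \<open>n\<close>, \<open>m\<close> can be compared directly.
\<close>

datatype var = VX nat | VY nat

type_synonym monom = "var \<Rightarrow>\<^sub>0 nat"
type_synonym xypoly = "monom \<Rightarrow>\<^sub>0 int"

definition X :: "nat \<Rightarrow> xypoly" where
  "X i = Poly_Mapping.single (Poly_Mapping.single (VX i) 1) 1"

definition Y :: "nat \<Rightarrow> xypoly" where
  "Y j = Poly_Mapping.single (Poly_Mapping.single (VY j) 1) 1"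

definition polys :: "nat \<Rightarrow> nat \<Rightarrow> xypoly set" where
  "polys n m = {q. \<forall>\<mu> \<in> Poly_Mapping.keys q. Poly_Mapping.keys \<mu> \<subseteq> VX ` {1..n} \<union> VY ` {1..m}}"

text \<open>Evaluation of \<open>q\<close> at \<open>X\<^sub>i := f i\<close>, \<open>Y\<^sub>j := g j\<close>.\<close>

definition subst :: "(nat \<Rightarrow> 'r) \<Rightarrow> (nat \<Rightarrow> 'r) \<Rightarrow> xypoly \<Rightarrow> 'r::comm_ring_1" where
  "subst f g q =
    (\<Sum>\<mu> \<in> Poly_Mapping.keys q. of_int (Poly_Mapping.lookup q \<mu>) *
      (\<Prod>v \<in> Poly_Mapping.keys \<mu>.
        (case v of VX i \<Rightarrow> f i | VY j \<Rightarrow> g j) ^ Poly_Mapping.lookup \<mu> v))"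

definition elem_sym :: "nat \<Rightarrow> 'i set \<Rightarrow> ('i \<Rightarrow> 'r) \<Rightarrow> 'r::comm_ring_1" where
  "elem_sym k I f = (\<Sum>S | S \<subseteq> I \<and> card S = k. \<Prod>i\<in>S. f i)"

definition Sigma_X :: "nat \<Rightarrow> nat \<Rightarrow> xypoly" where
  "Sigma_X n k = elem_sym k {1..n} X"

definition Sigma_Y :: "nat \<Rightarrow> nat \<Rightarrow> xypoly" where
  "Sigma_Y m k = elem_sym k {1..m} Y"

definition Sigma_tensor :: "nat \<Rightarrow> nat \<Rightarrow> nat \<Rightarrow> xypoly" where
  "Sigma_tensor n m p = elem_sym p ({1..n} \<times> {1..m}) (\<lambda>(i, j). X i * Y j)"

definition weight :: "monom \<Rightarrow> nat" where
  "weight \<mu> = (\<Sum>v \<in> Poly_Mapping.keys \<mu>.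
     (case v of VX i \<Rightarrow> i | VY j \<Rightarrow> j) * Poly_Mapping.lookup \<mu> v)"

end

theory Submission
  imports Defs "Jordan_Normal_Form.Determinant"
begin

text \<open>
  Let \<open>Z\<close> be the companion matrix with \<open>det (1 + y Z) = 1 + (\<Sum>k=1..p. e\<^sub>k(X) y ^ k)\<close>.  Modulo
  \<open>t ^ (p + 1)\<close>, multiplicativity of the determinant gives
  \<open>(\<Prod>i j. 1 + X\<^sub>i Y\<^sub>j t) = (\<Prod>j. det (1 + Y\<^sub>j t Z)) = det (\<Sum>k\<le>p. e\<^sub>k(Y) t ^ k Z ^ k)\<close>,
  whose coefficient at \<open>t ^ p\<close> is an integral polynomial in the \<open>e\<^sub>k(X)\<close>, \<open>e\<^sub>k(Y)\<close> that depends
  only on \<open>p\<close>.  Since \<open>\<Sigma>\<^sub>p\<close> of the products is homogeneous of degree \<open>2 p\<close>, only the monomials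
  of weight \<open>2 p\<close> matter.  The coefficient of \<open>X\<^sub>p Y\<^sub>p\<close> is found by setting all other variables
  to zero: then \<open>Z ^ p\<close> is scalar and the determinant is \<open>(1 - (- t) ^ p X\<^sub>p Y\<^sub>p) ^ p\<close>.
\<close>

section \<open>Elementary symmetric polynomials and their generating function\<close>

lemma elem_sym_0 [simp]: "elem_sym 0 I h = 1" if "finite I"
proof -
  have "{S. S \<subseteq> I \<and> card S = 0} = {{}}"
    using that by (auto simp: finite_subset)
  then show ?thesis by (simp add: elem_sym_def)
qed

lemma elem_sym_eq_0: "elem_sym k I h = 0" if "finite I" "card I < k"
proof -
  have "{S. S \<subseteq> I \<and> card S = k} = {}"
    using that by (auto dest: card_mono)
  then show ?thesis unfolding elem_sym_def by (simp only: sum.empty)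
qed

text \<open>The subsets of size \<open>Suc k\<close> are split by whether they contain
  \<open>i\<close>; removing \<open>i\<close> from those that do leaves subsets of \<open>I\<close>
  of size \<open>k\<close>.\<close>

lemma elem_sym_insert:
  assumes "finite I" "i \<notin> I"
  shows "elem_sym (Suc k) (insert i I) h = elem_sym (Suc k) I h + h i * elem_sym k I h"
proof -
  let ?A = "{S. S \<subseteq> I \<and> card S = Suc k}" and ?B = "{S. S \<subseteq> I \<and> card S = k}"
  have fin: "finite ?A" "finite ?B" using assms(1) by auto
  have split: "{S. S \<subseteq> insert i I \<and> card S = Suc k} = ?A \<union> insert i ` ?B" (is "?L = ?R")
  proof
    have "card (insert i S) = Suc (card S)" if "S \<subseteq> I" for S
      using that assms by (subst card_insert_disjoint) (auto simp: finite_subset)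
    then show "?R \<subseteq> ?L" by auto
    show "?L \<subseteq> ?R"
    proof
      fix S assume S: "S \<in> ?L"
      show "S \<in> ?R"
      proof (cases "i \<in> S")
        case True
        then have "S - {i} \<in> ?B" "S = insert i (S - {i})"
          using S by (auto simp: card_Diff_singleton_if)
        then show ?thesis by blast
      qed (use S in auto)
    qed
  qed
  have inj: "inj_on (insert i) ?B"
    using assms(2) by (auto simp: inj_on_def)
  have "elem_sym (Suc k) (insert i I) h = elem_sym (Suc k) I h + (\<Sum>S\<in>insert i ` ?B. prod h S)"
    unfolding elem_sym_def split using fin assms(2) by (subst sum.union_disjoint) auto
  also have "(\<Sum>S\<in>insert i ` ?B. prod h S) = (\<Sum>S\<in>?B. h i * prod h S)"
    unfolding sum.reindex[OF inj] using assms
    by (intro sum.cong) (auto simp: finite_subset intro!: prod.insert)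
  also have "\<dots> = h i * elem_sym k I h"
    by (simp add: elem_sym_def sum_distrib_left)
  finally show ?thesis .
qed

lemma elem_sym_scale: "elem_sym k I (\<lambda>i. c * h i) = c ^ k * elem_sym k I h"
  by (auto simp: elem_sym_def sum_distrib_left prod.distrib intro!: sum.cong)

lemma elem_sym_const_poly:
  fixes h :: "'a \<Rightarrow> 'r::comm_ring_1"
  shows "elem_sym k I (\<lambda>i. [:h i:]) = [:elem_sym k I h:]"
proof -
  have "(\<Prod>i\<in>S. [:h i:]) = [:\<Prod>i\<in>S. h i:]" for S
    by (induction S rule: infinite_finite_induct) (auto simp: one_pCons)
  moreover have "(\<Sum>S\<in>A. [:g S:]) = [:\<Sum>S\<in>A. g S:]" for A and g :: "'a set \<Rightarrow> 'r"
    by (induction A rule: infinite_finite_induct) auto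
  ultimately show ?thesis by (simp add: elem_sym_def)
qed

lemma elem_sym_monom: "elem_sym k I (\<lambda>i. monom (h i) 1) = monom (elem_sym k I h) k"
proof -
  have "(\<lambda>i. monom (h i) 1) = (\<lambda>i. monom 1 1 * [:h i:])"
    by (simp add: monom_altdef)
  then show ?thesis
    by (simp only: elem_sym_scale elem_sym_const_poly) (simp add: monom_altdef)
qed

text \<open>Terms beyond \<open>card I\<close> vanish, so any larger bound \<open>N\<close> serves
  as well. This freedom lets expansions of different lengths be brought to a common form.\<close>

lemma prod_one_plus_eq_sum_elem_sym:
  assumes "finite I" "card I \<le> N"
  shows "(\<Prod>i\<in>I. 1 + h i) = (\<Sum>k\<le>N. elem_sym k I h)"
  using assms
proof (induction I arbitrary: N)
  case empty
  have "(\<Sum>k\<le>N. elem_sym k {} h) = (\<Sum>k\<in>{0}. elem_sym k {} h)"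
    by (rule sum.mono_neutral_right) (auto simp: elem_sym_eq_0)
  then show ?case by simp
next
  case (insert i I)
  then obtain N' where N: "N = Suc N'" "card I \<le> N'" by (cases N) auto
  have "(\<Sum>k\<le>N. elem_sym k (insert i I) h)
      = 1 + (\<Sum>k\<le>N'. elem_sym (Suc k) I h + h i * elem_sym k I h)"
    unfolding N sum.atMost_Suc_shift using insert by (simp add: elem_sym_insert)
  also have "\<dots> = (\<Sum>k\<le>N. elem_sym k I h) + h i * (\<Sum>k\<le>N'. elem_sym k I h)"
    unfolding N sum.atMost_Suc_shift using insert(1)
    by (simp add: sum.distrib sum_distrib_left)
  also have "\<dots> = (1 + h i) * (\<Prod>i\<in>I. 1 + h i)"
    using insert.IH[of N] insert.IH[of N'] N by (simp add: algebra_simps)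
  finally show ?case using insert by simp
qed

lemma coeff_prod_one_plus_monom:
  assumes "finite I"
  shows "coeff (\<Prod>i\<in>I. 1 + monom (h i) 1) k = elem_sym k I h"
proof -
  \<comment> \<open>The bound \<open>max k (card I)\<close> makes the index \<open>k\<close> occur
    in the sum even when \<open>k\<close> exceeds \<open>card I\<close>.\<close>
  have "coeff (\<Prod>i\<in>I. 1 + monom (h i) 1) k = (\<Sum>l\<le>max k (card I). if l = k then elem_sym l I h else 0)"
    using prod_one_plus_eq_sum_elem_sym[OF assms, of "max k (card I)" "\<lambda>i. monom (h i) 1"]
    by (simp add: coeff_sum elem_sym_monom del: One_nat_def)
  then show ?thesis using assms by (simp add: elem_sym_eq_0)
qed

section \<open>Determinants of polynomials in the companion matrix\<close>

text \<open>The companion matrix \<open>Z\<close> satisfies \<open>det (1 + y Z) = 1 + (\<Sum>k=1..p. f k * y ^ k)\<close>.\<close>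

definition companion :: "(nat \<Rightarrow> 'r::comm_ring_1) \<Rightarrow> nat \<Rightarrow> nat \<Rightarrow> 'r" where
  "companion f c b = (if c = 0 then (- 1) ^ b * f (Suc b) else of_bool (c = Suc b))"

text \<open>Outside row 0, column \<open>b\<close> has only the entry 1 in row \<open>Suc b\<close>,
  which lies in the matrix unless \<open>b\<close> is the last column. The result is the recursion
  step of \<open>companion_pow\<close>.\<close>

lemma sum_mult_companion:
  assumes "b < p"
  shows "(\<Sum>c<p. w c * companion f c b)
    = (- 1) ^ b * f (Suc b) * w 0 + (if Suc b < p then w (Suc b) else 0)"
proof -
  obtain p' where p: "p = Suc p'" using assms by (cases p) auto
  have "(\<Sum>c<p. w c * companion f c b) = (- 1) ^ b * f (Suc b) * w 0 + (\<Sum>c<p'. if c = b then w (Suc c) else 0)"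
    unfolding p sum.lessThan_Suc_shift by (auto simp: companion_def intro!: sum.cong)
  then show ?thesis by (simp add: p)
qed

lemma det_one_plus_companion:
  fixes y :: "'r::comm_ring_1"
  assumes "p \<ge> 1"
  shows "det (mat p p (\<lambda>(c, b). of_bool (c = b) + y * companion f c b))
    = 1 + (\<Sum>k=1..p. f k * y ^ k)"
proof -
  let ?D = "mat p p (\<lambda>(c, b). of_bool (c = b) + y * companion f c b)"
  \<comment> \<open>\<open>l\<close> inverts \<open>1 + y N\<close> for the subdiagonal part \<open>N\<close> of the companion matrix, so that
    \<open>?D * ?L\<close> differs from the identity in the first row only.\<close>
  define l where "l i j = (if j \<le> i then (- y) ^ (i - j) else 0)" for i j :: nat
  let ?L = "mat p p (\<lambda>(i, j). l i j)"
  have entry: "(?D * ?L) $$ (i, j) = l i j + y * (\<Sum>b<p. companion f i b * l b j)"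
    if "i < p" "j < p" for i j
  proof -
    have "(?D * ?L) $$ (i, j) = (\<Sum>b<p. (of_bool (i = b) + y * companion f i b) * l b j)"
      using that by (simp add: scalar_prod_def atLeast0LessThan)
    also have "\<dots> = (\<Sum>b<p. (if b = i then l b j else 0) + y * (companion f i b * l b j))"
      by (intro sum.cong) (auto simp: algebra_simps)
    also have "\<dots> = l i j + y * (\<Sum>b<p. companion f i b * l b j)"
      using that by (simp add: sum.distrib sum_distrib_left)
    finally show ?thesis .
  qed
  have lower: "(?D * ?L) $$ (i, j) = of_bool (i = j)" if "0 < i" "i < p" "j < p" for i j
  proof -
    obtain i' where i: "i = Suc i'" using \<open>0 < i\<close> by (cases i) auto
    have "(\<Sum>b<p. companion f i b * l b j) = (\<Sum>b<p. if b = i' then l b j else 0)"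
      by (intro sum.cong) (auto simp: companion_def i)
    then have "(?D * ?L) $$ (i, j) = l (Suc i') j + y * l i' j"
      unfolding entry[OF that(2,3)] using that by (simp add: i)
    also have "\<dots> = of_bool (i = j)"
      by (auto simp: l_def i Suc_diff_le le_Suc_eq)
    finally show ?thesis .
  qed
  have corner: "(?D * ?L) $$ (0, 0) = 1 + (\<Sum>k=1..p. f k * y ^ k)"
  proof -
    have "y * (\<Sum>b<p. companion f 0 b * l b 0) = (\<Sum>b<p. f (Suc b) * y ^ Suc b)"
      unfolding sum_distrib_left
    proof (intro sum.cong refl)
      fix b
      \<comment> \<open>The alternating signs in the first row of the companion matrix are chosen to
        cancel those in the first column of \<open>?L\<close>.\<close>
      have "(- 1) ^ b * (- y) ^ b = y ^ b"
        by (simp flip: power_mult_distrib)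
      then show "y * (companion f 0 b * l b 0) = f (Suc b) * y ^ Suc b"
        by (simp add: companion_def l_def algebra_simps)
    qed
    also have "\<dots> = (\<Sum>k=1..p. f k * y ^ k)"
      by (rule sum.reindex_bij_witness[of _ "\<lambda>k. k - 1" Suc]) auto
    finally show ?thesis using assms by (subst entry) (auto simp: l_def)
  qed
  have "det (?D * ?L) = prod_list (diag_mat (?D * ?L))"
    by (rule det_upper_triangular[of _ p]) (auto intro!: upper_triangularI simp: lower simp del: index_mult_mat(1))
  also have "\<dots> = (\<Prod>i=0..<p. (?D * ?L) $$ (i, i))"
    by (simp add: prod_list_diag_prod)
  also have "\<dots> = (?D * ?L) $$ (0, 0) * (\<Prod>i=1..<p. (?D * ?L) $$ (i, i))"
    using assms by (subst prod.atLeast_Suc_lessThan) auto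
  also have "(\<Prod>i=1..<p. (?D * ?L) $$ (i, i)) = 1"
    by (rule prod.neutral) (auto simp: lower simp del: index_mult_mat(1))
  finally have "det (?D * ?L) = 1 + (\<Sum>k=1..p. f k * y ^ k)" by (simp add: corner)
  moreover have "det ?L = 1"
    by (subst det_lower_triangular[of p]) (auto simp: l_def prod_list_diag_prod)
  moreover have "det (?D * ?L) = det ?D * det ?L" by (rule det_mult) auto
  ultimately show ?thesis by simp
qed

text \<open>Recursion for the entries of \<open>Z ^ k\<close>.\<close>

fun companion_pow :: "nat \<Rightarrow> (nat \<Rightarrow> 'r::comm_ring_1) \<Rightarrow> nat \<Rightarrow> nat \<Rightarrow> nat \<Rightarrow> 'r" where
  "companion_pow p f 0 a b = of_bool (a = b)"
| "companion_pow p f (Suc k) a b = (- 1) ^ b * f (Suc b) * companion_pow p f k a 0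
     + (if Suc b < p then companion_pow p f k a (Suc b) else 0)"

definition companion_poly :: "nat \<Rightarrow> nat \<Rightarrow> (nat \<Rightarrow> 'r::comm_ring_1) \<Rightarrow> (nat \<Rightarrow> 'r) \<Rightarrow> 'r mat" where
  "companion_poly p N f g = mat p p (\<lambda>(a, b). \<Sum>k\<le>N. g k * companion_pow p f k a b)"

lemma companion_poly_carrier [simp]: "companion_poly p N f g \<in> carrier_mat p p"
  by (simp add: companion_poly_def)

text \<open>The matrix is the expanded product of the factors \<open>1 + y j * Z\<close>, and each
  factor has a known determinant. Inserting \<open>j\<close> multiplies on the right by one more
  factor, which matches the recursion of \<open>elem_sym\<close>.\<close>

lemma det_companion_poly_elem_sym:
  assumes "p \<ge> 1" "finite J" "card J \<le> N"
  shows "det (companion_poly p N f (\<lambda>k. elem_sym k J y)) = (\<Prod>j\<in>J. 1 + (\<Sum>k=1..p. f k * y j ^ k))"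
  using assms(2,3)
proof (induction J arbitrary: N)
  case empty
  have "(\<Sum>k\<le>N. elem_sym k {} y * companion_pow p f k a b)
      = (\<Sum>k\<in>{0}. elem_sym k {} y * companion_pow p f k a b)" for a b
    by (rule sum.mono_neutral_right) (auto simp: elem_sym_eq_0)
  then have "companion_poly p N f (\<lambda>k. elem_sym k {} y) = 1\<^sub>m p"
    unfolding companion_poly_def one_mat_def by (intro cong_mat) auto
  then show ?case by simp
next
  case (insert j J)
  then obtain N' where N: "N = Suc N'" "card J \<le> N'" by (cases N) auto
  let ?e = "\<lambda>k. elem_sym k J y" and ?W = "companion_pow p f"
  let ?D = "mat p p (\<lambda>(c, b). of_bool (c = b) + y j * companion f c b)"
  have "companion_poly p N f (\<lambda>k. elem_sym k (insert j J) y) = companion_poly p N f ?e * ?D"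
  proof (rule eq_matI)
    fix a b assume "a < dim_row (companion_poly p N f ?e * ?D)" "b < dim_col (companion_poly p N f ?e * ?D)"
    then have ab: "a < p" "b < p" by (auto simp: companion_poly_def)
    have "(companion_poly p N f ?e * ?D) $$ (a, b)
        = (\<Sum>c<p. (\<Sum>k\<le>N. ?e k * ?W k a c) * (of_bool (c = b) + y j * companion f c b))"
      using ab by (simp add: companion_poly_def scalar_prod_def atLeast0LessThan)
    also have "\<dots> = (\<Sum>c<p. (if c = b then (\<Sum>k\<le>N. ?e k * ?W k a c) else 0)
        + y j * (\<Sum>k\<le>N. ?e k * (?W k a c * companion f c b)))"
      by (intro sum.cong refl) (auto simp: algebra_simps sum_distrib_left sum.distrib)
    also have "\<dots> = (\<Sum>k\<le>N. ?e k * ?W k a b)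
        + y j * (\<Sum>k\<le>N. ?e k * (\<Sum>c<p. ?W k a c * companion f c b))"
    proof -
      have "(\<Sum>c<p. \<Sum>k\<le>N. ?e k * (?W k a c * companion f c b))
          = (\<Sum>k\<le>N. ?e k * (\<Sum>c<p. ?W k a c * companion f c b))"
        unfolding sum_distrib_left by (rule sum.swap)
      then show ?thesis using ab by (simp add: sum.distrib flip: sum_distrib_left)
    qed
    also have "\<dots> = (\<Sum>k\<le>N. ?e k * ?W k a b) + y j * (\<Sum>k\<le>N. ?e k * ?W (Suc k) a b)"
      unfolding sum_mult_companion[OF ab(2)] companion_pow.simps ..
    \<comment> \<open>Since \<open>card J < N\<close>, the coefficient \<open>?e N\<close> is zero,
      so no power of \<open>Z\<close> beyond \<open>N\<close> arises.\<close>
    also have "(\<Sum>k\<le>N. ?e k * ?W (Suc k) a b) = (\<Sum>k\<le>N'. ?e k * ?W (Suc k) a b)"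
      using elem_sym_eq_0[of J N y] insert(1) N by simp
    also have "(\<Sum>k\<le>N. ?e k * ?W k a b) + y j * \<dots>
        = (\<Sum>k\<le>N. elem_sym k (insert j J) y * ?W k a b)"
      unfolding N(1) sum.atMost_Suc_shift using insert(1,2)
      by (simp add: elem_sym_insert sum.distrib sum_distrib_left algebra_simps del: companion_pow.simps(2))
    finally show "companion_poly p N f (\<lambda>k. elem_sym k (insert j J) y) $$ (a, b)
        = (companion_poly p N f ?e * ?D) $$ (a, b)"
      using ab by (simp add: companion_poly_def)
  qed (auto simp: companion_poly_def)
  then have "det (companion_poly p N f (\<lambda>k. elem_sym k (insert j J) y))
      = det (companion_poly p N f ?e) * det ?D"
    by (simp add: det_mult[of _ p])
  then show ?case
    using insert N insert.IH[of N] by (simp add: det_one_plus_companion[OF assms(1)] mult.commute)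
qed

section \<open>Truncation of polynomials\<close>

text \<open>This is congruence modulo \<open>t ^ (n + 1)\<close>, phrased through coefficients
  because only the coefficient at \<open>t ^ p\<close> is wanted in the end.\<close>

definition agree :: "nat \<Rightarrow> 'r::comm_ring_1 poly \<Rightarrow> 'r poly \<Rightarrow> bool" where
  "agree n F G \<longleftrightarrow> (\<forall>k\<le>n. coeff F k = coeff G k)"

lemma agree_refl [simp]: "agree n F F"
  by (simp add: agree_def)

lemma agree_mult: "agree n F G \<Longrightarrow> agree n F' G' \<Longrightarrow> agree n (F * F') (G * G')"
  by (auto simp: agree_def coeff_mult intro!: sum.cong)

lemma agree_sum: "(\<And>i. i \<in> I \<Longrightarrow> agree n (F i) (G i)) \<Longrightarrow> agree n (sum F I) (sum G I)"
  by (auto simp: agree_def coeff_sum intro!: sum.cong)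

lemma agree_prod: "(\<And>i. i \<in> I \<Longrightarrow> agree n (F i) (G i)) \<Longrightarrow> agree n (prod F I) (prod G I)"
  by (induction I rule: infinite_finite_induct) (auto intro: agree_mult)

text \<open>By the Leibniz formula the determinant is built from the entries by sums and products,
  which respect the congruence.\<close>

lemma agree_det:
  assumes "A \<in> carrier_mat m m" "B \<in> carrier_mat m m"
    and "\<And>i j. i < m \<Longrightarrow> j < m \<Longrightarrow> agree n (A $$ (i, j)) (B $$ (i, j))"
  shows "agree n (det A) (det B)"
proof -
  have "\<pi> i < m" if "\<pi> permutes {0..<m}" "i < m" for \<pi> i
    using that permutes_in_image[of \<pi> "{0..<m}" i] by simp
  then show ?thesis
    unfolding det_def'[OF assms(1)] det_def'[OF assms(2)]
    by (auto intro!: agree_sum agree_mult agree_prod assms(3))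
qed

text \<open>The omitted terms are divisible by \<open>t ^ (n + 1)\<close>. This removes the
  dependence on the number of variables.\<close>

lemma agree_sum_monom:
  assumes "n \<le> N"
  shows "agree n (\<Sum>k\<le>N. monom (c k) k * F k) (\<Sum>k\<le>n. monom (c k) k * F k)"
proof -
  have "(\<Sum>k\<le>N. coeff (monom (c k) k * F k) l) = (\<Sum>k\<le>n. coeff (monom (c k) k * F k) l)" if "l \<le> n" for l
    using assms that by (intro sum.mono_neutral_right) (auto simp: coeff_monom_mult)
  then show ?thesis by (simp add: agree_def coeff_sum)
qed

section \<open>The universal expression for the symmetric functions of the products\<close>

text \<open>Here \<open>f\<close> and \<open>g\<close> stand for the elementary symmetric
  polynomials of the two families, and \<open>t\<close> is attached to \<open>g\<close> only. The
  coefficient at \<open>k = 0\<close> is fixed as 1, the value of \<open>elem_sym 0\<close>, so that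
  only the indices from 1 to \<open>p\<close> enter.\<close>

definition tensor_elem_sym :: "nat \<Rightarrow> (nat \<Rightarrow> 'r) \<Rightarrow> (nat \<Rightarrow> 'r) \<Rightarrow> 'r::comm_ring_1" where
  "tensor_elem_sym p f g = coeff (det (companion_poly p p (\<lambda>k. [:f k:])
     (\<lambda>k. if k = 0 then 1 else monom (g k) k))) p"

lemma elem_sym_prod_eq_tensor_elem_sym:
  fixes x :: "'i \<Rightarrow> 'r::comm_ring_1"
  assumes "p \<ge> 1" "finite I" "finite J"
  shows "elem_sym p (I \<times> J) (\<lambda>(i, j). x i * y j)
    = tensor_elem_sym p (\<lambda>k. elem_sym k I x) (\<lambda>k. elem_sym k J y)"
proof -
  \<comment> \<open>These bounds are large enough for the full expansions and at least
    \<open>p\<close>, so that the sums can then be cut down to \<open>p\<close>.\<close>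
  let ?N = "max p (card I)" and ?M = "max p (card J)"
  let ?f = "\<lambda>k. [:elem_sym k I x:]" and ?g = "\<lambda>k. monom (elem_sym k J y) k"
  let ?y = "\<lambda>j. monom (y j) 1"
  have xy: "monom (x i * y j) 1 = ?y j * [:x i:]" for i j
    by (simp add: monom_altdef ac_simps)
  \<comment> \<open>For fixed \<open>j\<close>, expanding in \<open>i\<close> and truncating gives
    \<open>det (1 + y j * t * Z)\<close>.\<close>
  have factor: "agree p (\<Prod>i\<in>I. 1 + monom (x i * y j) 1) (1 + (\<Sum>k=1..p. ?f k * ?y j ^ k))" for j
  proof -
    have "(\<Prod>i\<in>I. 1 + monom (x i * y j) 1) = (\<Sum>k\<le>?N. monom (y j ^ k) k * ?f k)"
      unfolding xy using assms(2)
      by (subst prod_one_plus_eq_sum_elem_sym[of _ ?N], simp, simp)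
        (simp only: elem_sym_scale elem_sym_const_poly monom_power mult_1_right mult_1_left)
    moreover have "(\<Sum>k\<le>p. monom (y j ^ k) k * ?f k) = 1 + (\<Sum>k=1..p. ?f k * ?y j ^ k)"
    proof -
      have "{..p} = insert 0 {1..p}" by auto
      then show ?thesis using assms(2) by (simp add: monom_power ac_simps one_pCons monom_0)
    qed
    ultimately show ?thesis using agree_sum_monom[of p ?N "\<lambda>k. y j ^ k" ?f] by simp
  qed
  have "elem_sym p (I \<times> J) (\<lambda>(i, j). x i * y j)
      = coeff (\<Prod>z\<in>I \<times> J. 1 + monom (case z of (i, j) \<Rightarrow> x i * y j) 1) p"
    using assms by (simp only: coeff_prod_one_plus_monom finite_cartesian_product)
  also have "(\<Prod>z\<in>I \<times> J. 1 + monom (case z of (i, j) \<Rightarrow> x i * y j) 1)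
      = (\<Prod>j\<in>J. \<Prod>i\<in>I. 1 + monom (x i * y j) 1)"
    by (subst prod.swap) (simp add: prod.cartesian_product case_prod_beta)
  also have "coeff \<dots> p = coeff (\<Prod>j\<in>J. 1 + (\<Sum>k=1..p. ?f k * ?y j ^ k)) p"
    using agree_prod[of J p, OF factor] by (simp add: agree_def)
  also have "\<dots> = coeff (det (companion_poly p ?M ?f (\<lambda>k. elem_sym k J ?y))) p"
    using assms by (simp add: det_companion_poly_elem_sym)
  also have "\<dots> = coeff (det (companion_poly p ?M ?f ?g)) p"
    unfolding elem_sym_monom ..
  also have "\<dots> = coeff (det (companion_poly p p ?f ?g)) p"
  proof -
    have "agree p (det (companion_poly p ?M ?f ?g)) (det (companion_poly p p ?f ?g))"
      by (rule agree_det[of _ p]) (auto simp: companion_poly_def intro!: agree_sum_monom)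
    then show ?thesis by (simp add: agree_def)
  qed
  also have "?g = (\<lambda>k. if k = 0 then 1 else ?g k)"
    using assms(3) by (auto simp: fun_eq_iff)
  finally show ?thesis by (simp add: tensor_elem_sym_def)
qed

text \<open>With only \<open>f p\<close> left, \<open>Z\<close> is a cyclic shift whose wrap-around
  entry is \<open>(- 1) ^ (p - 1) * f p\<close>. For \<open>k \<le> p\<close> at most one wrap
  occurs; at \<open>k = p\<close> only the wrapped term remains, so \<open>Z ^ p\<close> is
  scalar.\<close>

lemma companion_pow_monomial:
  assumes "\<And>i. 1 \<le> i \<Longrightarrow> i < p \<Longrightarrow> f i = 0" "k \<le> p" "a < p" "b < p"
  shows "companion_pow p f k a b
    = of_bool (a = b + k) + of_bool (a + p = b + k) * (- 1) ^ (p - 1) * f p"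
  using assms(2,4)
proof (induction k arbitrary: b)
  case (Suc k)
  show ?case
  proof (cases "Suc b < p")
    case False
    then have "p = Suc b" using Suc.prems by simp
    then show ?thesis using Suc assms(3) by auto
  qed (use Suc assms in auto)
qed (use assms(3) in auto)

text \<open>Only the terms for \<open>k = 0\<close> and \<open>k = p\<close> survive, and both are
  scalar matrices. The factor \<open>p\<close> comes from the size of the matrix, as the exponent of
  the determinant.\<close>

lemma tensor_elem_sym_top:
  assumes "p \<ge> 1"
  shows "tensor_elem_sym p (\<lambda>k. if k = p then u else 0) (\<lambda>k. if k = p then v else 0)
    = (- 1) ^ (p - 1) * of_nat p * (u * v)"
proof -
  define w where "w = (- 1) ^ (p - 1) * (u * v)"
  let ?f = "\<lambda>k. [:if k = p then u else 0:]" and ?g = "\<lambda>k. if k = 0 then 1 else monom (if k = p then v else 0) k"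
  let ?c = "1 + monom w p"
  have "companion_poly p p ?f ?g = ?c \<cdot>\<^sub>m 1\<^sub>m p"
  proof (rule eq_matI)
    fix a b assume "a < dim_row (?c \<cdot>\<^sub>m 1\<^sub>m p)" "b < dim_col (?c \<cdot>\<^sub>m 1\<^sub>m p)"
    then have ab: "a < p" "b < p" by auto
    have "(\<Sum>k\<le>p. ?g k * companion_pow p ?f k a b) = (\<Sum>k\<in>{0, p}. ?g k * companion_pow p ?f k a b)"
      by (rule sum.mono_neutral_right) auto
    also have "\<dots> = of_bool (a = b) + monom v p * companion_pow p ?f p a b"
      using assms by simp
    also have "companion_pow p ?f p a b = of_bool (a = b) * (- 1) ^ (p - 1) * [:u:]"
      using ab by (subst companion_pow_monomial) auto
    also have "of_bool (a = b) + monom v p * \<dots> = of_bool (a = b) * ?c"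
    proof -
      have "monom v p * ((- 1) ^ (p - 1) * [:u:]) = monom w p"
        by (cases "even (p - 1)") (simp_all add: w_def monom_altdef ac_simps)
      then show ?thesis by auto
    qed
    finally show "companion_poly p p ?f ?g $$ (a, b) = (?c \<cdot>\<^sub>m 1\<^sub>m p) $$ (a, b)"
      using ab by (auto simp: companion_poly_def)
  qed (auto simp: companion_poly_def)
  then have det: "det (companion_poly p p ?f ?g) = ?c ^ p" by simp
  have c0: "coeff (?c ^ n) 0 = 1" for n
    using assms by (induction n) (auto simp: coeff_mult)
  \<comment> \<open>Each further factor \<open>?c\<close> adds \<open>w\<close> times the constant
    coefficient 1.\<close>
  have "coeff (?c ^ n) p = of_nat n * w" for n
    using assms by (induction n) (auto simp: algebra_simps coeff_monom_mult c0)
  then show ?thesis by (simp add: tensor_elem_sym_def det w_def)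
qed

section \<open>Substitution as a ring homomorphism\<close>

lemma poly_mapping_eq_sum_single:
  fixes q :: "'a \<Rightarrow>\<^sub>0 'b::comm_monoid_add"
  shows "q = (\<Sum>\<mu>\<in>Poly_Mapping.keys q. Poly_Mapping.single \<mu> (Poly_Mapping.lookup q \<mu>))"
  by (rule poly_mapping_eqI) (simp add: lookup_sum lookup_single when_def in_keys_iff)

definition monom_val :: "(nat \<Rightarrow> 'r) \<Rightarrow> (nat \<Rightarrow> 'r) \<Rightarrow> monom \<Rightarrow> 'r::comm_ring_1" where
  "monom_val f g \<mu> = (\<Prod>v\<in>Poly_Mapping.keys \<mu>.
     (case v of VX i \<Rightarrow> f i | VY j \<Rightarrow> g j) ^ Poly_Mapping.lookup \<mu> v)"

lemma monom_val_superset: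
  assumes "finite A" "Poly_Mapping.keys \<mu> \<subseteq> A"
  shows "monom_val f g \<mu> = (\<Prod>v\<in>A. (case v of VX i \<Rightarrow> f i | VY j \<Rightarrow> g j) ^ Poly_Mapping.lookup \<mu> v)"
  unfolding monom_val_def using assms by (intro prod.mono_neutral_left) (auto simp: in_keys_iff)

lemma monom_val_0 [simp]: "monom_val f g 0 = 1"
  by (simp add: monom_val_def)

lemma monom_val_add: "monom_val f g (\<mu> + \<nu>) = monom_val f g \<mu> * monom_val f g \<nu>"
proof -
  let ?A = "Poly_Mapping.keys \<mu> \<union> Poly_Mapping.keys \<nu>"
  have "Poly_Mapping.keys (\<mu> + \<nu>) \<subseteq> ?A" by (rule keys_add)
  then show ?thesis
    by (simp add: monom_val_superset[of ?A] lookup_add power_add prod.distrib)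
qed

lemma subst_superset:
  assumes "finite A" "Poly_Mapping.keys q \<subseteq> A"
  shows "subst f g q = (\<Sum>\<mu>\<in>A. of_int (Poly_Mapping.lookup q \<mu>) * monom_val f g \<mu>)"
  unfolding subst_def monom_val_def using assms by (intro sum.mono_neutral_left) (auto simp: in_keys_iff)

lemma subst_0 [simp]: "subst f g 0 = 0"
  by (simp add: subst_def)

lemma subst_add: "subst f g (q + r) = subst f g q + subst f g r"
proof -
  let ?A = "Poly_Mapping.keys q \<union> Poly_Mapping.keys r"
  have "Poly_Mapping.keys (q + r) \<subseteq> ?A" by (rule keys_add)
  then show ?thesis
    by (simp add: subst_superset[of ?A] lookup_add sum.distrib algebra_simps)
qed

lemma subst_sum: "subst f g (sum q A) = (\<Sum>a\<in>A. subst f g (q a))"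
  by (induction A rule: infinite_finite_induct) (auto simp: subst_add)

lemma subst_single: "subst f g (Poly_Mapping.single \<mu> c) = of_int c * monom_val f g \<mu>"
  by (subst subst_superset[of "{\<mu>}"]) auto

lemma subst_mult: "subst f g (q * r) = subst f g q * subst f g r"
proof -
  let ?s = "\<lambda>q \<mu>. Poly_Mapping.single \<mu> (Poly_Mapping.lookup q \<mu>)"
  have "q * r = (\<Sum>\<mu>\<in>Poly_Mapping.keys q. \<Sum>\<nu>\<in>Poly_Mapping.keys r. ?s q \<mu> * ?s r \<nu>)"
    by (subst (1) poly_mapping_eq_sum_single[of q], subst (1) poly_mapping_eq_sum_single[of r]) (rule sum_product)
  then have "subst f g (q * r) = (\<Sum>\<mu>\<in>Poly_Mapping.keys q. \<Sum>\<nu>\<in>Poly_Mapping.keys r.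
      subst f g (?s q \<mu>) * subst f g (?s r \<nu>))"
    by (simp add: subst_sum subst_single mult_single monom_val_add ac_simps)
  also have "\<dots> = subst f g (\<Sum>\<mu>\<in>Poly_Mapping.keys q. ?s q \<mu>) * subst f g (\<Sum>\<nu>\<in>Poly_Mapping.keys r. ?s r \<nu>)"
    by (simp add: subst_sum sum_product)
  finally show ?thesis by (simp flip: poly_mapping_eq_sum_single)
qed

lemma polys_add: "q \<in> polys n m \<Longrightarrow> r \<in> polys n m \<Longrightarrow> q + r \<in> polys n m"
  using keys_add[of q r] unfolding polys_def by blast

lemma polys_mult:
  assumes "q \<in> polys n m" "r \<in> polys n m"
  shows "q * r \<in> polys n m"
  unfolding polys_def
proof clarify
  fix \<mu> v assume "\<mu> \<in> Poly_Mapping.keys (q * r)" "v \<in> Poly_Mapping.keys \<mu>" "v \<notin> VY ` {1..m}"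
  moreover from this obtain \<mu>' \<nu>' where "\<mu> = \<mu>' + \<nu>'" "\<mu>' \<in> Poly_Mapping.keys q" "\<nu>' \<in> Poly_Mapping.keys r"
    using keys_mult[of q r] by blast
  ultimately show "v \<in> VX ` {1..n}"
    using assms keys_add[of \<mu>' \<nu>'] unfolding polys_def by blast
qed

lemma polys_const: "Poly_Mapping.single 0 c \<in> polys n m"
  by (simp add: polys_def)

lemma X_in_polys: "i \<in> {1..n} \<Longrightarrow> X i \<in> polys n m"
  and Y_in_polys: "j \<in> {1..m} \<Longrightarrow> Y j \<in> polys n m"
  by (auto simp: polys_def X_def Y_def)

lemma subst_X [simp]: "subst f g (X i) = f i"
  and subst_Y [simp]: "subst f g (Y j) = g j"
  by (simp_all add: X_def Y_def subst_single monom_val_def)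

section \<open>Representability by integral polynomials\<close>

text \<open>The polynomial is chosen before \<open>f\<close> and \<open>g\<close>, which makes it
  universal. Closure under the ring operations gives its existence without an explicit
  formula.\<close>

definition representable :: "nat \<Rightarrow> ((nat \<Rightarrow> 'r::comm_ring_1) \<Rightarrow> (nat \<Rightarrow> 'r) \<Rightarrow> 'r) \<Rightarrow> bool" where
  "representable p F \<longleftrightarrow> (\<exists>q\<in>polys p p. \<forall>f g. F f g = subst f g q)"

lemma representable_const: "representable p (\<lambda>_ _. of_int c)"
  unfolding representable_def
  by (rule bexI[of _ "Poly_Mapping.single 0 c"]) (simp_all add: subst_single polys_const)

lemma representable_add: "representable p F \<Longrightarrow> representable p G \<Longrightarrow> representable p (\<lambda>f g. F f g + G f g)"
  unfolding representable_def using subst_add polys_add by metis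

lemma representable_mult: "representable p F \<Longrightarrow> representable p G \<Longrightarrow> representable p (\<lambda>f g. F f g * G f g)"
  unfolding representable_def using subst_mult polys_mult by metis

lemma representable_sum:
  "(\<And>i. i \<in> I \<Longrightarrow> representable p (F i)) \<Longrightarrow> representable p (\<lambda>f g. \<Sum>i\<in>I. F i f g)"
  by (induction I rule: infinite_finite_induct)
    (use representable_const[of p 0] in \<open>auto intro: representable_add\<close>)

lemma representable_X: "i \<in> {1..p} \<Longrightarrow> representable p (\<lambda>f g. f i)"
  and representable_Y: "i \<in> {1..p} \<Longrightarrow> representable p (\<lambda>f g. g i)"
  unfolding representable_def by (metis subst_X X_in_polys, metis subst_Y Y_in_polys)

text \<open>The determinant lives in polynomials in \<open>t\<close>, so closure is needed at the
  level of all their coefficients.\<close>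

definition coeffs_representable :: "nat \<Rightarrow> ((nat \<Rightarrow> 'r::comm_ring_1) \<Rightarrow> (nat \<Rightarrow> 'r) \<Rightarrow> 'r poly) \<Rightarrow> bool" where
  "coeffs_representable p F \<longleftrightarrow> (\<forall>k. representable p (\<lambda>f g. coeff (F f g) k))"

lemma coeffs_representable_monom:
  "representable p F \<Longrightarrow> coeffs_representable p (\<lambda>f g. monom (F f g) k)"
  unfolding coeffs_representable_def
proof
  fix l
  assume "representable p F"
  then show "representable p (\<lambda>f g. coeff (monom (F f g) k) l)"
    using representable_const[of p 0] by (cases "k = l") simp_all
qed

lemma coeffs_representable_pCons: "representable p F \<Longrightarrow> coeffs_representable p (\<lambda>f g. [:F f g:])"
  using coeffs_representable_monom[of p F 0] by (simp add: monom_0)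

lemma coeffs_representable_const: "coeffs_representable p (\<lambda>_ _. of_int c)"
  using coeffs_representable_pCons[OF representable_const[of p c]] by (simp add: of_int_poly)

lemma coeffs_representable_add:
  "coeffs_representable p F \<Longrightarrow> coeffs_representable p G \<Longrightarrow> coeffs_representable p (\<lambda>f g. F f g + G f g)"
  by (simp add: coeffs_representable_def representable_add)

lemma coeffs_representable_mult:
  "coeffs_representable p F \<Longrightarrow> coeffs_representable p G \<Longrightarrow> coeffs_representable p (\<lambda>f g. F f g * G f g)"
  by (simp add: coeffs_representable_def coeff_mult representable_sum representable_mult)

lemma coeffs_representable_sum:
  "(\<And>i. i \<in> I \<Longrightarrow> coeffs_representable p (F i)) \<Longrightarrow> coeffs_representable p (\<lambda>f g. \<Sum>i\<in>I. F i f g)"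
  by (simp add: coeffs_representable_def coeff_sum representable_sum)

lemma coeffs_representable_prod:
  "(\<And>i. i \<in> I \<Longrightarrow> coeffs_representable p (F i)) \<Longrightarrow> coeffs_representable p (\<lambda>f g. \<Prod>i\<in>I. F i f g)"
  by (induction I rule: infinite_finite_induct)
    (use coeffs_representable_const[of p 1] in \<open>auto intro: coeffs_representable_mult\<close>)

lemma coeffs_representable_companion_pow:
  "b < p \<Longrightarrow> coeffs_representable p (\<lambda>(f :: nat \<Rightarrow> 'r::comm_ring_1) g. companion_pow p (\<lambda>k. [:f k:]) k a b)"
proof (induction k arbitrary: b)
  case 0
  show ?case using coeffs_representable_const[of p "of_bool (a = b)"] by simp
next
  case (Suc k)
  have "coeffs_representable p (\<lambda>(f :: nat \<Rightarrow> 'r) g. if Suc b < p then companion_pow p (\<lambda>k. [:f k:]) k a (Suc b) else 0)"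
    using Suc.IH[of "Suc b"] coeffs_representable_const[of p 0]
    by (cases "Suc b < p") simp_all
  moreover have "coeffs_representable p (\<lambda>f g. (- 1) ^ b :: 'r poly)"
    using coeffs_representable_const[of p "(- 1) ^ b"] by simp
  \<comment> \<open>The bound \<open>b < p\<close> keeps the index \<open>Suc b\<close> between 1
    and \<open>p\<close>.\<close>
  moreover have "coeffs_representable p (\<lambda>f g. [:f (Suc b):])"
    using Suc.prems by (intro coeffs_representable_pCons representable_X) auto
  ultimately show ?case
    using Suc.IH[of 0] Suc.prems unfolding companion_pow.simps
    by (intro coeffs_representable_add coeffs_representable_mult) auto
qed

text \<open>The Leibniz formula writes the determinant as a signed sum of products of entries, all
  with representable coefficients.\<close>

lemma representable_tensor_elem_sym:
  "representable p (tensor_elem_sym p :: (nat \<Rightarrow> 'r::comm_ring_1) \<Rightarrow> _)"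
proof -
  let ?M = "\<lambda>(f :: nat \<Rightarrow> 'r) g. companion_poly p p (\<lambda>k. [:f k:]) (\<lambda>k. if k = 0 then 1 else monom (g k) k)"
  have g: "coeffs_representable p (\<lambda>f g. if k = 0 then 1 else monom (g k) k)" if "k \<le> p" for k
    using that coeffs_representable_const[of p 1]
    by (cases "k = 0") (auto intro!: coeffs_representable_monom representable_Y)
  have entry: "coeffs_representable p (\<lambda>f g. ?M f g $$ (a, b))" if "a < p" "b < p" for a b
    using that by (auto simp: companion_poly_def
      intro!: coeffs_representable_sum coeffs_representable_mult coeffs_representable_companion_pow g)
  have "coeffs_representable p (\<lambda>f g. signof \<pi> * (\<Prod>i=0..<p. ?M f g $$ (i, \<pi> i)))"
    if "\<pi> permutes {0..<p}" for \<pi>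
  proof (intro coeffs_representable_mult coeffs_representable_prod entry)
    show "coeffs_representable p (\<lambda>f g. signof \<pi> :: 'r poly)"
      using coeffs_representable_const[of p "signof \<pi>"] by simp
    show "\<pi> i < p" if "i \<in> {0..<p}" for i
      using that permutes_in_image[OF \<open>\<pi> permutes {0..<p}\<close>, of i] by simp
  qed auto
  then have "coeffs_representable p (\<lambda>f g. det (?M f g))"
    unfolding det_def'[OF companion_poly_carrier] by (intro coeffs_representable_sum) auto
  then show ?thesis
    unfolding tensor_elem_sym_def[abs_def] coeffs_representable_def by blast
qed

section \<open>Homogeneity and weight\<close>

text \<open>Every variable counts with degree 1, in contrast to \<open>weight\<close>, where
  \<open>VX i\<close> and \<open>VY i\<close> count with \<open>i\<close>.\<close>

definition total_degree :: "monom \<Rightarrow> nat" where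
  "total_degree \<mu> = (\<Sum>v\<in>Poly_Mapping.keys \<mu>. Poly_Mapping.lookup \<mu> v)"

lemma total_degree_add: "total_degree (\<mu> + \<nu>) = total_degree \<mu> + total_degree \<nu>"
  unfolding total_degree_def by (rule setsum_keys_plus_distrib) auto

definition homogeneous :: "nat \<Rightarrow> xypoly \<Rightarrow> bool" where
  "homogeneous d q \<longleftrightarrow> (\<forall>\<mu>\<in>Poly_Mapping.keys q. total_degree \<mu> = d)"

lemma homogeneous_const: "homogeneous 0 (of_int c)"
  by (simp add: homogeneous_def total_degree_def flip: single_of_int)

lemma homogeneous_mult:
  assumes "homogeneous d q" "homogeneous e r"
  shows "homogeneous (d + e) (q * r)"
  using assms keys_mult[of q r] unfolding homogeneous_def by (force simp: total_degree_add)

lemma homogeneous_sum: "(\<And>i. i \<in> I \<Longrightarrow> homogeneous d (q i)) \<Longrightarrow> homogeneous d (sum q I)"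
  using keys_sum[of q I] unfolding homogeneous_def by blast

lemma homogeneous_prod:
  "(\<And>i. i \<in> I \<Longrightarrow> homogeneous (d i) (q i)) \<Longrightarrow> homogeneous (sum d I) (prod q I)"
  by (induction I rule: infinite_finite_induct)
    (use homogeneous_const[of 1] in \<open>auto intro: homogeneous_mult\<close>)

lemma homogeneous_power: "homogeneous d q \<Longrightarrow> homogeneous (d * k) (q ^ k)"
  using homogeneous_prod[of "{..<k}" "\<lambda>_. d" "\<lambda>_. q"] by (simp add: mult.commute)

lemma homogeneous_elem_sym:
  assumes "\<And>i. homogeneous d (q i)"
  shows "homogeneous (k * d) (elem_sym k I q)"
  unfolding elem_sym_def
proof (rule homogeneous_sum)
  fix S assume "S \<in> {S. S \<subseteq> I \<and> card S = k}"
  then show "homogeneous (k * d) (prod q S)"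
    using homogeneous_prod[of S "\<lambda>_. d" q] assms by simp
qed

lemma homogeneous_X: "homogeneous 1 (X i)"
  and homogeneous_Y: "homogeneous 1 (Y i)"
  by (simp_all add: homogeneous_def X_def Y_def total_degree_def)

text \<open>Substituting forms of degree \<open>k\<close> for the \<open>k\<close>-th variables
  turns weight into total degree.\<close>

lemma homogeneous_monom_val:
  assumes "\<And>k. homogeneous k (f k)" "\<And>k. homogeneous k (g k)"
  shows "homogeneous (weight \<mu>) (monom_val f g \<mu>)"
  unfolding weight_def monom_val_def
  by (intro homogeneous_prod homogeneous_power) (auto split: var.split intro: assms)

definition weight_part :: "nat \<Rightarrow> xypoly \<Rightarrow> xypoly" where
  "weight_part d q = (\<Sum>\<mu>\<in>{\<mu>\<in>Poly_Mapping.keys q. weight \<mu> = d}. Poly_Mapping.single \<mu> (Poly_Mapping.lookup q \<mu>))"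

lemma lookup_weight_part:
  "Poly_Mapping.lookup (weight_part d q) \<mu> = (if weight \<mu> = d then Poly_Mapping.lookup q \<mu> else 0)"
  by (auto simp: weight_part_def lookup_sum lookup_single when_def in_keys_iff)

lemma keys_weight_part:
  "Poly_Mapping.keys (weight_part d q) = {\<mu>\<in>Poly_Mapping.keys q. weight \<mu> = d}"
  by (auto simp: in_keys_iff lookup_weight_part split: if_splits)

text \<open>The part of \<open>q\<close> of weight \<open>e\<close> is sent to degree
  \<open>e\<close>. If the whole image has degree \<open>d\<close>, the contributions of all other
  weights cancel.\<close>

lemma subst_weight_part:
  assumes f: "\<And>k. homogeneous k (f k)" and g: "\<And>k. homogeneous k (g k)"
    and hom: "homogeneous d (subst f g q)"
  shows "subst f g (weight_part d q) = subst f g q"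
proof (rule poly_mapping_eqI)
  fix \<nu>
  let ?t = "\<lambda>\<mu>. of_int (Poly_Mapping.lookup q \<mu>) * monom_val f g \<mu>"
  let ?K = "{\<mu>\<in>Poly_Mapping.keys q. weight \<mu> = d}"
  have term_hom: "homogeneous (weight \<mu>) (?t \<mu>)" for \<mu>
    using homogeneous_mult[OF homogeneous_const homogeneous_monom_val[of f g, OF f g]] by simp
  have part: "subst f g (weight_part d q) = (\<Sum>\<mu>\<in>?K. ?t \<mu>)"
    by (subst subst_superset[of ?K]) (auto simp: keys_weight_part lookup_weight_part)
  have q: "subst f g q = (\<Sum>\<mu>\<in>Poly_Mapping.keys q. ?t \<mu>)"
    by (rule subst_superset) auto
  show "Poly_Mapping.lookup (subst f g (weight_part d q)) \<nu> = Poly_Mapping.lookup (subst f g q) \<nu>"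
  \<comment> \<open>In degree \<open>d\<close> only terms of weight \<open>d\<close> contribute; in
    any other degree both sides have coefficient zero.\<close>
  proof (cases "total_degree \<nu> = d")
    case True
    then have "Poly_Mapping.lookup (?t \<mu>) \<nu> = 0" if "weight \<mu> \<noteq> d" for \<mu>
      using that term_hom[of \<mu>] unfolding homogeneous_def by (metis in_keys_iff)
    then show ?thesis
      unfolding part q lookup_sum by (intro sum.mono_neutral_left) auto
  next
    case False
    have "homogeneous d (subst f g (weight_part d q))"
      unfolding part by (rule homogeneous_sum) (use term_hom in auto)
    with hom False show ?thesis
      unfolding homogeneous_def by (metis in_keys_iff)
  qed
qed

section \<open>The coefficient of the product of the two top variables\<close>

lemma monom_val_top:
  "monom_val (\<lambda>k. if k = p then X p else 0) (\<lambda>k. if k = p then Y p else 0) \<mu>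
    = (if Poly_Mapping.keys \<mu> \<subseteq> {VX p, VY p} then Poly_Mapping.single \<mu> 1 else 0)"
proof (cases "Poly_Mapping.keys \<mu> \<subseteq> {VX p, VY p}")
  case True
  let ?x = "\<lambda>v. Poly_Mapping.single (Poly_Mapping.single v 1) 1 :: xypoly"
  have power: "?x v ^ k = Poly_Mapping.single (Poly_Mapping.single v k) 1" for v k
    by (induction k) (simp_all add: mult_single flip: single_add)
  have "(\<Prod>v\<in>A. Poly_Mapping.single (h v) 1 :: xypoly) = Poly_Mapping.single (sum h A) 1" for A and h :: "var \<Rightarrow> monom"
    by (induction A rule: infinite_finite_induct) (simp_all add: mult_single)
  then have "(\<Prod>v\<in>Poly_Mapping.keys \<mu>. ?x v ^ Poly_Mapping.lookup \<mu> v) = Poly_Mapping.single \<mu> 1"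
    unfolding power by (simp flip: poly_mapping_eq_sum_single)
  moreover have "monom_val (\<lambda>k. if k = p then X p else 0) (\<lambda>k. if k = p then Y p else 0) \<mu>
      = (\<Prod>v\<in>Poly_Mapping.keys \<mu>. ?x v ^ Poly_Mapping.lookup \<mu> v)"
    unfolding monom_val_def using True by (intro prod.cong) (auto simp: X_def Y_def)
  ultimately show ?thesis using True by simp
next
  case False
  then obtain v where v: "v \<in> Poly_Mapping.keys \<mu>" "v \<noteq> VX p" "v \<noteq> VY p" by blast
  have "monom_val (\<lambda>k. if k = p then X p else 0) (\<lambda>k. if k = p then Y p else 0) \<mu> = 0"
    unfolding monom_val_def
    by (rule prod_zero) (use v in \<open>auto split: var.split simp: in_keys_iff power_0_left intro!: bexI[of _ v]\<close>)
  then show ?thesis using False by simp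
qed

text \<open>Setting all variables except \<open>X p\<close> and \<open>Y p\<close> to zero kills the
  other monomials and fixes those in these two variables, so their coefficients can be read off
  after the substitution.\<close>

lemma lookup_subst_top:
  assumes "Poly_Mapping.keys \<mu> \<subseteq> {VX p, VY p}"
  shows "Poly_Mapping.lookup (subst (\<lambda>k. if k = p then X p else 0) (\<lambda>k. if k = p then Y p else 0) q) \<mu>
    = Poly_Mapping.lookup q \<mu>"
proof -
  have "Poly_Mapping.lookup (of_int c * Poly_Mapping.single \<nu> (1::int)) \<mu> = (if \<nu> = \<mu> then c else 0)" for c \<nu>
    by (simp add: mult_single lookup_single when_def flip: single_of_int)
  then have "Poly_Mapping.lookup (of_int c * (if Poly_Mapping.keys \<nu> \<subseteq> {VX p, VY p} then Poly_Mapping.single \<nu> 1 else 0)) \<mu>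
      = (if \<nu> = \<mu> then c else 0)" for c \<nu>
    using assms by auto
  then show ?thesis
    by (simp add: subst_superset[of "Poly_Mapping.keys q" q] lookup_sum monom_val_top in_keys_iff)
qed

section \<open>The universal polynomial, its weight and its leading term\<close>

theorem proposition2p1:
  fixes p :: nat
  assumes "p \<ge> 1"
  shows "\<exists>Q \<in> polys p p.
    (\<forall>n m. n \<ge> p \<longrightarrow> m \<ge> p \<longrightarrow> Sigma_tensor n m p = subst (Sigma_X n) (Sigma_Y m) Q) \<and>
    (\<exists>P \<in> polys p p.
      (- 1) ^ p * Q = - (of_nat p * X p * Y p) + P \<and>
      Poly_Mapping.single (VX p) 1 + Poly_Mapping.single (VY p) 1 \<notin> Poly_Mapping.keys P \<and>
      (\<forall>\<mu> \<in> Poly_Mapping.keys P. weight \<mu> = 2 * p))"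
proof -
  \<comment> \<open>The coefficient ring is taken to be \<open>xypoly\<close> itself, which covers
    both substitutions: the symmetric polynomials, and the top variables with zeros
    elsewhere.\<close>
  obtain q :: xypoly where q: "q \<in> polys p p"
    and tensor: "\<And>f g. tensor_elem_sym p f g = (subst f g q :: xypoly)"
    using representable_tensor_elem_sym[of p] unfolding representable_def by metis
  \<comment> \<open>Discarding all other weights secures the weight claim and does not change the
    value at the symmetric polynomials, which is homogeneous of degree \<open>2 * p\<close>.\<close>
  define Q where "Q = weight_part (2 * p) q"
  define \<mu> where "\<mu> = Poly_Mapping.single (VX p) (1::nat) + Poly_Mapping.single (VY p) 1"
  define P where "P = (- 1) ^ p * Q + of_nat p * X p * Y p"
  have XY: "of_nat p * X p * Y p = Poly_Mapping.single \<mu> (int p)"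
    by (simp add: X_def Y_def \<mu>_def mult_single flip: single_of_nat)
  \<comment> \<open>As a constant polynomial, the sign falls under the closure rules for
    \<open>polys\<close>.\<close>
  have sign: "(- 1) ^ p * r = Poly_Mapping.single 0 ((- 1) ^ p) * r" for r :: xypoly
    by (cases "even p") (simp_all add: single_uminus)
  have lookup_P: "Poly_Mapping.lookup P \<nu>
      = (- 1) ^ p * Poly_Mapping.lookup Q \<nu> + (if \<nu> = \<mu> then int p else 0)" for \<nu>
    unfolding P_def XY by (cases "even p") (auto simp: lookup_add lookup_minus lookup_single when_def)
  have keys_\<mu>: "Poly_Mapping.keys \<mu> = {VX p, VY p}"
    by (auto simp: \<mu>_def in_keys_iff lookup_add lookup_single when_def split: if_splits)
  have weight_\<mu>: "weight \<mu> = 2 * p"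
    unfolding weight_def keys_\<mu> by (simp add: \<mu>_def lookup_add lookup_single)
  have Q: "Q \<in> polys p p"
    using q by (auto simp: polys_def Q_def keys_weight_part)
  have "Sigma_tensor n m p = subst (Sigma_X n) (Sigma_Y m) Q" for n m
  proof -
    have T: "Sigma_tensor n m p = subst (Sigma_X n) (Sigma_Y m) q"
      using elem_sym_prod_eq_tensor_elem_sym[OF assms, of "{1..n}" "{1..m}" X Y]
      by (simp add: Sigma_tensor_def Sigma_X_def[abs_def] Sigma_Y_def[abs_def] tensor)
    have X: "homogeneous k (Sigma_X n k)" and Y: "homogeneous k (Sigma_Y m k)" for k
      using homogeneous_elem_sym[of 1 X k, OF homogeneous_X] homogeneous_elem_sym[of 1 Y k, OF homogeneous_Y]
      by (simp_all add: Sigma_X_def Sigma_Y_def)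
    have "homogeneous 2 (case z of (i, j) \<Rightarrow> X i * Y j)" for z
      using homogeneous_mult[OF homogeneous_X homogeneous_Y] by (auto simp: numeral_2_eq_2 split: prod.split)
    then have "homogeneous (2 * p) (Sigma_tensor n m p)"
      unfolding Sigma_tensor_def using homogeneous_elem_sym by (metis mult.commute)
    then show ?thesis
      unfolding Q_def T by (intro subst_weight_part[symmetric] X Y)
  qed
  moreover have "P \<in> polys p p"
    unfolding P_def sign using assms
    by (intro polys_add polys_mult polys_const Q X_in_polys Y_in_polys) (auto simp: polys_const simp flip: single_of_nat)
  moreover have "(- 1) ^ p * Q = - (of_nat p * X p * Y p) + P"
    by (simp add: P_def)
  moreover have "\<mu> \<notin> Poly_Mapping.keys P"
  proof -
    \<comment> \<open>The monomial \<mu> has weight \<open>2 * p\<close>, so passing from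
      \<open>q\<close> to \<open>Q\<close> keeps its coefficient.\<close>
    have "Poly_Mapping.lookup Q \<mu> = Poly_Mapping.lookup q \<mu>"
      by (simp add: Q_def lookup_weight_part weight_\<mu>)
    also have "\<dots> = Poly_Mapping.lookup (tensor_elem_sym p (\<lambda>k. if k = p then X p else 0) (\<lambda>k. if k = p then Y p else 0)) \<mu>"
      unfolding tensor by (rule lookup_subst_top[symmetric]) (simp add: keys_\<mu>)
    also have "\<dots> = Poly_Mapping.lookup ((- 1) ^ (p - 1) * Poly_Mapping.single \<mu> (int p)) \<mu>"
      using assms by (simp add: tensor_elem_sym_top mult.assoc flip: XY)
    also have "\<dots> = (- 1) ^ (p - 1) * int p"
      by (cases "even (p - 1)") simp_all
    \<comment> \<open>The signs \<open>(- 1) ^ p\<close> and \<open>(- 1) ^ (p - 1)\<close> multiply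
      to -1 because \<open>p \<ge> 1\<close>, so the coefficient \<open>- p\<close> cancels the
      added \<open>p\<close>.\<close>
    finally have "Poly_Mapping.lookup P \<mu> = 0"
      using assms by (cases p) (simp_all add: lookup_P flip: power_add mult.assoc)
    then show ?thesis by (simp add: in_keys_iff)
  qed
  \<comment> \<open>A monomial of \<open>P\<close> comes from \<open>Q\<close> or is \<mu>, and both
    cases have weight \<open>2 * p\<close>.\<close>
  moreover have "weight \<nu> = 2 * p" if "\<nu> \<in> Poly_Mapping.keys P" for \<nu>
    using that weight_\<mu> by (auto simp: in_keys_iff lookup_P Q_def lookup_weight_part split: if_splits)
  ultimately show ?thesis using Q unfolding \<mu>_def by blast
qed

end
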